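(* Let ${\cal L}$ be a partial structure and $\varphi$ a closed formula with ${\sf reduce}({\cal L},\varphi)=\psi$. Then for every partial structure ${\cal L}'\geq{\cal L}$: (1) ${\cal L}'\models\varphi$ iff ${\cal L}'\models\psi$, and (2) ${\cal L}'\models\overline{\varphi}$ iff ${\cal L}'\models\overline{\psi}$.
   Context: Predicates are objective or subjective; each predicate $p$ has a dual $\overline p$ of the same kind, $\overline{\overline p}=p$. Atoms are $p(t_1,\ldots,t_n)$, plus special objective atoms $\vec t\not\in S$ and their duals $\vec t\in S$ ($S$ a finite set of tuples of ground terms). Restrictions: $c ::= p_O(t_1,\ldots,t_n)\mid\vec x\not\in S\mid\top\mid\bot\mid c_1\wedge c_2\mid c_1\vee c_2\mid\exists x.c$ ($p_O$ objective). Formulas: $\varphi ::= P\mid\top\mid\bot\mid\varphi_1\wedge\varphi_2\mid\varphi_1\vee\varphi_2\mid\forall\vec x.(c\supset\varphi)\mid\exists\vec x.(c\wedge\varphi)$. Dual: $\overline{p(\vec t)}=\overline p(\vec t)$, $\overline{\vec t\not\in S}=(\vec t\in S)$, $\overline\top=\bot$, $\overline\bot=\top$, $\overline{\varphi\wedge\psi}=\overline\varphi\vee\overline\psi$, $\overline{\varphi\vee\psi}=\overline\varphi\wedge\overline\psi$, $\overline{\forall\vec x.(c\supset\varphi)}=\exists\vec x.(c\wedge\overline\varphi)$, $\overline{\exists\vec x.(c\wedge\varphi)}=\forall\vec x.(c\supset\overline\varphi)$, $\overline{\exists x.c}=\forall x.(\top\supset\overline c)$. A partial structure ${\cal L}$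 over a domain $\mathrm{D}$ (ground terms) is a total function $\rho_{\cal L}$ from ground atoms to $\{{\tt tt},{\tt ff},{\tt uu}\}$ with $\rho_{\cal L}(\overline P)=\overline{\rho_{\cal L}(P)}$ ($\overline{{\tt tt}}={\tt ff}$, $\overline{{\tt ff}}={\tt tt}$, $\overline{{\tt uu}}={\tt uu}$) and $\rho_{\cal L}(\vec t\not\in S)={\tt tt}$ iff $\vec t\notin S$, else ${\tt ff}$. Truth of closed formulas: ${\cal L}\models P$ iff $\rho_{\cal L}(P)={\tt tt}$; ${\cal L}\models\top$; ${\cal L}\not\models\bot$; $\wedge,\vee$ as usual; ${\cal L}\models\forall\vec x.(c\supset\varphi)$ iff for all $\vec t\in\mathrm D$, ${\cal L}\models\overline c[\vec t/\vec x]$ or ${\cal L}\models\varphi[\vec t/\vec x]$; ${\cal L}\models\exists\vec x.(c\wedge\varphi)$ iff for some $\vec t\in\mathrm D$, ${\cal L}\models c[\vec t/\vec x]$ and ${\cal L}\models\varphi[\vec t/\vec x]$; ${\cal L}\models\exists x.c$ iff ${\cal L}\models c[t/x]$ for some $t$. Extension: ${\cal L}_1\geq{\cal L}_2$ iff for all ground atoms $P$, $\rho_{{\cal L}_2}(P)\in\{{\tt tt},{\tt ff}\}$ implies $\rho_{{\cal L}_1}(P)=\rho_{{\cal L}_2}(P)$. Substitutions map finitely many variables to ground terms; $\bullet$ is the empty one; $\sigma'\geq\sigma$ means $\sigma'$ extends $\sigma$; $\sigma_1+\sigma_2$ is union; $\sigma\backslash\{x\}$ removes $x$. Each objective predicate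 $p_O$ has input positions $I(p_O)$ and output positions $O(p_O)$ (all positions of $\vec x\not\in S$ are input). A function ${\tt sat}$ is given: for each ${\cal L}$ and objective atom $P=p_O(t_1,\ldots,t_n)$ whose input arguments are ground, ${\tt sat}({\cal L},P)$ is a finite set of substitutions, each with domain containing $\bigcup_{j\in O(p_O)}\mathrm{fv}(t_j)$, such that for all $\sigma'$ with $\mathrm{dom}(\sigma')\supseteq\mathrm{fv}(P)$, ${\cal L}\models P\sigma'$ iff $\sigma'\geq\sigma$ for some $\sigma\in{\tt sat}({\cal L},P)$; it is undefined otherwise (for ground $\vec t$, ${\tt sat}({\cal L},\vec t\not\in S)=\{\bullet\}$ if $\vec t\notin S$, $\{\}$ otherwise). $\widehat{{\tt sat}}$: $\widehat{{\tt sat}}({\cal L},p_O(\vec t))={\tt sat}({\cal L},p_O(\vec t))$; $\widehat{{\tt sat}}({\cal L},\top)=\{\bullet\}$; $\widehat{{\tt sat}}({\cal L},\bot)=\{\}$; $\widehat{{\tt sat}}({\cal L},c_1\wedge c_2)=\bigcup_{\sigma_1\in\widehat{{\tt sat}}({\cal L},c_1)}\{\sigma_1+\sigma_2:\sigma_2\in\widehat{{\tt sat}}({\cal L},c_2\sigma_1)\}$; $\widehat{{\tt sat}}({\cal L},c_1\vee c_2)=\widehat{{\tt sat}}({\cal L},c_1)\cup\widehat{{\tt sat}}({\cal L},c_2)$; $\widehat{{\tt sat}}({\cal L},\exists x.c)=\{\sigma\backslash\{x\}:\sigma\in\widehat{{\tt sat}}({\cal L},c)\}$; defined only when all constituent calls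 are. ${\sf reduce}$ (partial, on closed formulas): for a ground atom $P$, ${\sf reduce}({\cal L},P)$ is $\top$, $\bot$, $P$ according as $\rho_{\cal L}(P)$ is ${\tt tt}$, ${\tt ff}$, ${\tt uu}$; ${\sf reduce}({\cal L},\top)=\top$, ${\sf reduce}({\cal L},\bot)=\bot$; it commutes with $\wedge$ and $\vee$. For $\forall\vec x.(c\supset\varphi')$: let $\{\sigma_1,\ldots,\sigma_n\}=\widehat{{\tt sat}}({\cal L},c)$, $\vec t_i=\sigma_i(\vec x)$, $S=\{\vec t_1,\ldots,\vec t_n\}$, $\psi_i={\sf reduce}({\cal L},\varphi'[\vec t_i/\vec x])$; result $\psi_1\wedge\cdots\wedge\psi_n\wedge\forall\vec x.((c\wedge\vec x\not\in S)\supset\varphi')$. For $\exists\vec x.(c\wedge\varphi')$: result $\psi_1\vee\cdots\vee\psi_n\vee\exists\vec x.((c\wedge\vec x\not\in S)\wedge\varphi')$. Defined only when all constituent calls are defined. *)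

theory Defs
  imports Main "HOL-Library.FSet"
begin

section \<open>Syntax\<close>

datatype ('f, 'v) trm = Var 'v | Fun 'f "('f, 'v) trm list"

fun fv_trm :: "('f, 'v) trm \<Rightarrow> 'v set" where
  "fv_trm (Var x) = {x}"
| "fv_trm (Fun f ts) = (\<Union>t\<in>set ts. fv_trm t)"

abbreviation fv_trms :: "('f, 'v) trm list \<Rightarrow> 'v set" where
  "fv_trms ts \<equiv> (\<Union>t\<in>set ts. fv_trm t)"

abbreviation ground :: "('f, 'v) trm \<Rightarrow> bool" where
  "ground t \<equiv> fv_trm t = {}"

text \<open>
  \<open>NotIn ts S\<close> and \<open>In ts S\<close> are the special objective atoms for non-membership and membership of
  the tuple \<open>ts\<close> in the finite set \<open>S\<close>; the tuples in \<open>S\<close> are ground (see \<open>wf_atom\<close>).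
\<close>

datatype ('f, 'v, 'o, 's) atom =
    Obj 'o "('f, 'v) trm list"
  | Subj 's "('f, 'v) trm list"
  | NotIn "('f, 'v) trm list" "('f, 'v) trm list fset"
  | In "('f, 'v) trm list" "('f, 'v) trm list fset"

text \<open>The list in \<open>RNotIn\<close> consists of variables initially, but becomes ground by substitution.\<close>

datatype ('f, 'v, 'o) restr =
    RPred 'o "('f, 'v) trm list"
  | RNotIn "('f, 'v) trm list" "('f, 'v) trm list fset"
  | RTop
  | RBot
  | RAnd "('f, 'v, 'o) restr" "('f, 'v, 'o) restr"
  | ROr "('f, 'v, 'o) restr" "('f, 'v, 'o) restr"
  | REx 'v "('f, 'v, 'o) restr"

text \<open>\<open>All xs c \<phi>\<close> is \<open>\<forall>xs. (c \<supset> \<phi>)\<close> and \<open>Ex xs c \<phi>\<close> is \<open>\<exists>xs. (c \<and> \<phi>)\<close>.\<close>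

datatype ('f, 'v, 'o, 's) fm =
    Atom "('f, 'v, 'o, 's) atom"
  | Top
  | Bot
  | And "('f, 'v, 'o, 's) fm" "('f, 'v, 'o, 's) fm"
  | Or "('f, 'v, 'o, 's) fm" "('f, 'v, 'o, 's) fm"
  | All "'v list" "('f, 'v, 'o) restr" "('f, 'v, 'o, 's) fm"
  | Ex "'v list" "('f, 'v, 'o) restr" "('f, 'v, 'o, 's) fm"

fun fv_atom :: "('f, 'v, 'o, 's) atom \<Rightarrow> 'v set" where
  "fv_atom (Obj p ts) = fv_trms ts"
| "fv_atom (Subj p ts) = fv_trms ts"
| "fv_atom (NotIn ts S) = fv_trms ts"
| "fv_atom (In ts S) = fv_trms ts"

abbreviation ground_atom :: "('f, 'v, 'o, 's) atom \<Rightarrow> bool" where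
  "ground_atom P \<equiv> fv_atom P = {}"

primrec fv_restr :: "('f, 'v, 'o) restr \<Rightarrow> 'v set" where
  "fv_restr (RPred p ts) = fv_trms ts"
| "fv_restr (RNotIn ts S) = fv_trms ts"
| "fv_restr RTop = {}"
| "fv_restr RBot = {}"
| "fv_restr (RAnd c d) = fv_restr c \<union> fv_restr d"
| "fv_restr (ROr c d) = fv_restr c \<union> fv_restr d"
| "fv_restr (REx x c) = fv_restr c - {x}"

primrec fv_fm :: "('f, 'v, 'o, 's) fm \<Rightarrow> 'v set" where
  "fv_fm (Atom P) = fv_atom P"
| "fv_fm Top = {}"
| "fv_fm Bot = {}"
| "fv_fm (And \<phi> \<psi>) = fv_fm \<phi> \<union> fv_fm \<psi>"
| "fv_fm (Or \<phi> \<psi>) = fv_fm \<phi> \<union> fv_fm \<psi>"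
| "fv_fm (All xs c \<phi>) = (fv_restr c \<union> fv_fm \<phi>) - set xs"
| "fv_fm (Ex xs c \<phi>) = (fv_restr c \<union> fv_fm \<phi>) - set xs"

abbreviation closed :: "('f, 'v, 'o, 's) fm \<Rightarrow> bool" where
  "closed \<phi> \<equiv> fv_fm \<phi> = {}"

abbreviation ground_tuples :: "('f, 'v) trm list fset \<Rightarrow> bool" where
  "ground_tuples S \<equiv> (\<forall>ts. ts |\<in>| S \<longrightarrow> fv_trms ts = {})"

fun wf_atom :: "('f, 'v, 'o, 's) atom \<Rightarrow> bool" where
  "wf_atom (Obj p ts) \<longleftrightarrow> True"
| "wf_atom (Subj p ts) \<longleftrightarrow> True"
| "wf_atom (NotIn ts S) \<longleftrightarrow> ground_tuples S"
| "wf_atom (In ts S) \<longleftrightarrow> ground_tuples S"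

primrec wf_restr :: "('f, 'v, 'o) restr \<Rightarrow> bool" where
  "wf_restr (RPred p ts) \<longleftrightarrow> True"
| "wf_restr (RNotIn ts S) \<longleftrightarrow> ground_tuples S"
| "wf_restr RTop \<longleftrightarrow> True"
| "wf_restr RBot \<longleftrightarrow> True"
| "wf_restr (RAnd c d) \<longleftrightarrow> wf_restr c \<and> wf_restr d"
| "wf_restr (ROr c d) \<longleftrightarrow> wf_restr c \<and> wf_restr d"
| "wf_restr (REx x c) \<longleftrightarrow> wf_restr c"

primrec wf_fm :: "('f, 'v, 'o, 's) fm \<Rightarrow> bool" where
  "wf_fm (Atom P) \<longleftrightarrow> wf_atom P"
| "wf_fm Top \<longleftrightarrow> True"
| "wf_fm Bot \<longleftrightarrow> True"
| "wf_fm (And \<phi> \<psi>) \<longleftrightarrow> wf_fm \<phi> \<and> wf_fm \<psi>"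
| "wf_fm (Or \<phi> \<psi>) \<longleftrightarrow> wf_fm \<phi> \<and> wf_fm \<psi>"
| "wf_fm (All xs c \<phi>) \<longleftrightarrow> distinct xs \<and> wf_restr c \<and> wf_fm \<phi>"
| "wf_fm (Ex xs c \<phi>) \<longleftrightarrow> distinct xs \<and> wf_restr c \<and> wf_fm \<phi>"


section \<open>Signatures\<close>

text \<open>
  Objective and subjective predicates form separate types, so duals preserve the kind. Argument
  positions are counted from 0; arities are not fixed, and positions beyond the length of an
  argument list are ignored. \<open>domain\<close> is the domain \<open>D\<close> over which quantifiers and substitutions
  range. It is a parameter so that it can be, for example, the set of ground terms that respect
  given arities of the function symbols.
\<close>

record ('f, 'v, 'o, 's) signature =
  odual :: "'o \<Rightarrow> 'o"
  sdual :: "'s \<Rightarrow> 's"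
  in_pos :: "'o \<Rightarrow> nat set"
  out_pos :: "'o \<Rightarrow> nat set"
  domain :: "('f, 'v) trm set"

definition wf_signature :: "('f, 'v, 'o, 's) signature \<Rightarrow> bool" where
  "wf_signature \<Sigma> \<longleftrightarrow>
    (\<forall>p. odual \<Sigma> (odual \<Sigma> p) = p) \<and>
    (\<forall>p. sdual \<Sigma> (sdual \<Sigma> p) = p) \<and>
    domain \<Sigma> \<noteq> {} \<and> (\<forall>t\<in>domain \<Sigma>. ground t)"


section \<open>Duals\<close>

fun dual_atom :: "('f, 'v, 'o, 's) signature \<Rightarrow> ('f, 'v, 'o, 's) atom \<Rightarrow> ('f, 'v, 'o, 's) atom" where
  "dual_atom \<Sigma> (Obj p ts) = Obj (odual \<Sigma> p) ts"
| "dual_atom \<Sigma> (Subj p ts) = Subj (sdual \<Sigma> p) ts"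
| "dual_atom \<Sigma> (NotIn ts S) = In ts S"
| "dual_atom \<Sigma> (In ts S) = NotIn ts S"

primrec dual_restr :: "('f, 'v, 'o, 's) signature \<Rightarrow> ('f, 'v, 'o) restr \<Rightarrow> ('f, 'v, 'o, 's) fm" where
  "dual_restr \<Sigma> (RPred p ts) = Atom (dual_atom \<Sigma> (Obj p ts))"
| "dual_restr \<Sigma> (RNotIn ts S) = Atom (dual_atom \<Sigma> (NotIn ts S))"
| "dual_restr \<Sigma> RTop = Bot"
| "dual_restr \<Sigma> RBot = Top"
| "dual_restr \<Sigma> (RAnd c d) = Or (dual_restr \<Sigma> c) (dual_restr \<Sigma> d)"
| "dual_restr \<Sigma> (ROr c d) = And (dual_restr \<Sigma> c) (dual_restr \<Sigma> d)"
| "dual_restr \<Sigma> (REx x c) = All [x] RTop (dual_restr \<Sigma> c)"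

primrec dual :: "('f, 'v, 'o, 's) signature \<Rightarrow> ('f, 'v, 'o, 's) fm \<Rightarrow> ('f, 'v, 'o, 's) fm" where
  "dual \<Sigma> (Atom P) = Atom (dual_atom \<Sigma> P)"
| "dual \<Sigma> Top = Bot"
| "dual \<Sigma> Bot = Top"
| "dual \<Sigma> (And \<phi> \<psi>) = Or (dual \<Sigma> \<phi>) (dual \<Sigma> \<psi>)"
| "dual \<Sigma> (Or \<phi> \<psi>) = And (dual \<Sigma> \<phi>) (dual \<Sigma> \<psi>)"
| "dual \<Sigma> (All xs c \<phi>) = Ex xs c (dual \<Sigma> \<phi>)"
| "dual \<Sigma> (Ex xs c \<phi>) = All xs c (dual \<Sigma> \<phi>)"


section \<open>Substitutions\<close>

type_synonym ('f, 'v) subst = "'v \<rightharpoonup> ('f, 'v) trm"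

definition is_subst :: "('f, 'v, 'o, 's) signature \<Rightarrow> ('f, 'v) subst \<Rightarrow> bool" where
  "is_subst \<Sigma> \<sigma> \<longleftrightarrow> finite (dom \<sigma>) \<and> ran \<sigma> \<subseteq> domain \<Sigma>"

text \<open>\<open>\<sigma>' \<ge> \<sigma>\<close> is \<open>\<sigma> \<subseteq>\<^sub>m \<sigma>'\<close>, and \<open>\<sigma>\<^sub>1 + \<sigma>\<^sub>2\<close> is \<open>\<sigma>\<^sub>1 ++ \<sigma>\<^sub>2\<close>, which is the union only for compatible maps.\<close>

definition compatible :: "('f, 'v) subst \<Rightarrow> ('f, 'v) subst \<Rightarrow> bool" where
  "compatible \<sigma> \<tau> \<longleftrightarrow> (\<forall>x\<in>dom \<sigma> \<inter> dom \<tau>. \<sigma> x = \<tau> x)"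

primrec subst_trm :: "('f, 'v) subst \<Rightarrow> ('f, 'v) trm \<Rightarrow> ('f, 'v) trm" where
  "subst_trm \<sigma> (Var x) = (case \<sigma> x of None \<Rightarrow> Var x | Some t \<Rightarrow> t)"
| "subst_trm \<sigma> (Fun f ts) = Fun f (map (subst_trm \<sigma>) ts)"

fun subst_atom :: "('f, 'v) subst \<Rightarrow> ('f, 'v, 'o, 's) atom \<Rightarrow> ('f, 'v, 'o, 's) atom" where
  "subst_atom \<sigma> (Obj p ts) = Obj p (map (subst_trm \<sigma>) ts)"
| "subst_atom \<sigma> (Subj p ts) = Subj p (map (subst_trm \<sigma>) ts)"
| "subst_atom \<sigma> (NotIn ts S) = NotIn (map (subst_trm \<sigma>) ts) S"
| "subst_atom \<sigma> (In ts S) = In (map (subst_trm \<sigma>) ts) S"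

primrec subst_restr :: "('f, 'v) subst \<Rightarrow> ('f, 'v, 'o) restr \<Rightarrow> ('f, 'v, 'o) restr" where
  "subst_restr \<sigma> (RPred p ts) = RPred p (map (subst_trm \<sigma>) ts)"
| "subst_restr \<sigma> (RNotIn ts S) = RNotIn (map (subst_trm \<sigma>) ts) S"
| "subst_restr \<sigma> RTop = RTop"
| "subst_restr \<sigma> RBot = RBot"
| "subst_restr \<sigma> (RAnd c d) = RAnd (subst_restr \<sigma> c) (subst_restr \<sigma> d)"
| "subst_restr \<sigma> (ROr c d) = ROr (subst_restr \<sigma> c) (subst_restr \<sigma> d)"
| "subst_restr \<sigma> (REx x c) = REx x (subst_restr (\<sigma>(x := None)) c)"

primrec subst_fm :: "('f, 'v) subst \<Rightarrow> ('f, 'v, 'o, 's) fm \<Rightarrow> ('f, 'v, 'o, 's) fm" where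
  "subst_fm \<sigma> (Atom P) = Atom (subst_atom \<sigma> P)"
| "subst_fm \<sigma> Top = Top"
| "subst_fm \<sigma> Bot = Bot"
| "subst_fm \<sigma> (And \<phi> \<psi>) = And (subst_fm \<sigma> \<phi>) (subst_fm \<sigma> \<psi>)"
| "subst_fm \<sigma> (Or \<phi> \<psi>) = Or (subst_fm \<sigma> \<phi>) (subst_fm \<sigma> \<psi>)"
| "subst_fm \<sigma> (All xs c \<phi>) =
    All xs (subst_restr (\<sigma> |` (- set xs)) c) (subst_fm (\<sigma> |` (- set xs)) \<phi>)"
| "subst_fm \<sigma> (Ex xs c \<phi>) =
    Ex xs (subst_restr (\<sigma> |` (- set xs)) c) (subst_fm (\<sigma> |` (- set xs)) \<phi>)"


section \<open>Partial structures and truth\<close>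

datatype tv = TT | FF | UU

fun dual_tv :: "tv \<Rightarrow> tv" where
  "dual_tv TT = FF"
| "dual_tv FF = TT"
| "dual_tv UU = UU"

text \<open>A structure is identified with its map \<open>\<rho>\<close>, of which only the values at ground atoms matter.\<close>

type_synonym ('f, 'v, 'o, 's) struct = "('f, 'v, 'o, 's) atom \<Rightarrow> tv"

definition partial_structure ::
    "('f, 'v, 'o, 's) signature \<Rightarrow> ('f, 'v, 'o, 's) struct \<Rightarrow> bool" where
  "partial_structure \<Sigma> L \<longleftrightarrow>
    (\<forall>P. ground_atom P \<longrightarrow> L (dual_atom \<Sigma> P) = dual_tv (L P)) \<and>
    (\<forall>ts S. ground_atom (NotIn ts S :: ('f, 'v, 'o, 's) atom) \<longrightarrow>
      L (NotIn ts S) = (if ts |\<notin>| S then TT else FF))"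

definition extends :: "('f, 'v, 'o, 's) struct \<Rightarrow> ('f, 'v, 'o, 's) struct \<Rightarrow> bool" where
  "extends L1 L2 \<longleftrightarrow> (\<forall>P. ground_atom P \<longrightarrow> L2 P \<in> {TT, FF} \<longrightarrow> L1 P = L2 P)"

primrec rsize :: "('f, 'v, 'o) restr \<Rightarrow> nat" where
  "rsize (RPred p ts) = 1"
| "rsize (RNotIn ts S) = 1"
| "rsize RTop = 1"
| "rsize RBot = 1"
| "rsize (RAnd c d) = 1 + rsize c + rsize d"
| "rsize (ROr c d) = 1 + rsize c + rsize d"
| "rsize (REx x c) = 2 + rsize c"

primrec fsize :: "('f, 'v, 'o, 's) fm \<Rightarrow> nat" where
  "fsize (Atom P) = 1"
| "fsize Top = 1"
| "fsize Bot = 1"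
| "fsize (And \<phi> \<psi>) = 1 + fsize \<phi> + fsize \<psi>"
| "fsize (Or \<phi> \<psi>) = 1 + fsize \<phi> + fsize \<psi>"
| "fsize (All xs c \<phi>) = 1 + rsize c + fsize \<phi>"
| "fsize (Ex xs c \<phi>) = 1 + rsize c + fsize \<phi>"

lemma rsize_subst [simp]: "rsize (subst_restr \<sigma> c) = rsize c"
  by (induction c arbitrary: \<sigma>) auto

lemma fsize_subst [simp]: "fsize (subst_fm \<sigma> \<phi>) = fsize \<phi>"
  by (induction \<phi> arbitrary: \<sigma>) auto

lemma fsize_dual_restr [simp]: "fsize (dual_restr \<Sigma> c) = rsize c"
  by (induction c) auto

function models_restr ::
    "('f, 'v, 'o, 's) signature \<Rightarrow> ('f, 'v, 'o, 's) struct \<Rightarrow> ('f, 'v, 'o) restr \<Rightarrow> bool" where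
  "models_restr \<Sigma> L (RPred p ts) \<longleftrightarrow> L (Obj p ts) = TT"
| "models_restr \<Sigma> L (RNotIn ts S) \<longleftrightarrow> L (NotIn ts S) = TT"
| "models_restr \<Sigma> L RTop \<longleftrightarrow> True"
| "models_restr \<Sigma> L RBot \<longleftrightarrow> False"
| "models_restr \<Sigma> L (RAnd c d) \<longleftrightarrow> models_restr \<Sigma> L c \<and> models_restr \<Sigma> L d"
| "models_restr \<Sigma> L (ROr c d) \<longleftrightarrow> models_restr \<Sigma> L c \<or> models_restr \<Sigma> L d"
| "models_restr \<Sigma> L (REx x c) \<longleftrightarrow> (\<exists>t\<in>domain \<Sigma>. models_restr \<Sigma> L (subst_restr [x \<mapsto> t] c))"
  by pat_completeness auto
termination
  by (relation "measure (\<lambda>(\<Sigma>, L, c). rsize c)") auto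

function models ::
    "('f, 'v, 'o, 's) signature \<Rightarrow> ('f, 'v, 'o, 's) struct \<Rightarrow> ('f, 'v, 'o, 's) fm \<Rightarrow> bool" where
  "models \<Sigma> L (Atom P) \<longleftrightarrow> L P = TT"
| "models \<Sigma> L Top \<longleftrightarrow> True"
| "models \<Sigma> L Bot \<longleftrightarrow> False"
| "models \<Sigma> L (And \<phi> \<psi>) \<longleftrightarrow> models \<Sigma> L \<phi> \<and> models \<Sigma> L \<psi>"
| "models \<Sigma> L (Or \<phi> \<psi>) \<longleftrightarrow> models \<Sigma> L \<phi> \<or> models \<Sigma> L \<psi>"
| "models \<Sigma> L (All xs c \<phi>) \<longleftrightarrow>
    (\<forall>ts. length ts = length xs \<and> set ts \<subseteq> domain \<Sigma> \<longrightarrow>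
      models \<Sigma> L (subst_fm [xs [\<mapsto>] ts] (dual_restr \<Sigma> c)) \<or>
      models \<Sigma> L (subst_fm [xs [\<mapsto>] ts] \<phi>))"
| "models \<Sigma> L (Ex xs c \<phi>) \<longleftrightarrow>
    (\<exists>ts. length ts = length xs \<and> set ts \<subseteq> domain \<Sigma> \<and>
      models_restr \<Sigma> L (subst_restr [xs [\<mapsto>] ts] c) \<and>
      models \<Sigma> L (subst_fm [xs [\<mapsto>] ts] \<phi>))"
  by pat_completeness auto
termination
  by (relation "measure (\<lambda>(\<Sigma>, L, \<phi>). fsize \<phi>)") auto


section \<open>The function sat\<close>

fun objective :: "('f, 'v, 'o, 's) atom \<Rightarrow> bool" where
  "objective (Subj p ts) \<longleftrightarrow> False"
| "objective _ \<longleftrightarrow> True"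

fun in_args :: "('f, 'v, 'o, 's) signature \<Rightarrow> ('f, 'v, 'o, 's) atom \<Rightarrow> ('f, 'v) trm set" where
  "in_args \<Sigma> (Obj p ts) = {ts ! j | j. j \<in> in_pos \<Sigma> p \<and> j < length ts}"
| "in_args \<Sigma> (NotIn ts S) = set ts"
| "in_args \<Sigma> (In ts S) = set ts"
| "in_args \<Sigma> (Subj p ts) = {}"

fun out_args :: "('f, 'v, 'o, 's) signature \<Rightarrow> ('f, 'v, 'o, 's) atom \<Rightarrow> ('f, 'v) trm set" where
  "out_args \<Sigma> (Obj p ts) = {ts ! j | j. j \<in> out_pos \<Sigma> p \<and> j < length ts}"
| "out_args \<Sigma> _ = {}"

text \<open>Partial functions returning a set of substitutions; \<open>None\<close> stands for undefined.\<close>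

type_synonym ('f, 'v, 'o, 's) sat_fun =
  "('f, 'v, 'o, 's) struct \<Rightarrow> ('f, 'v, 'o, 's) atom \<Rightarrow> ('f, 'v) subst set option"

text \<open>
  The specification of \<open>sat\<close> at one structure \<open>L\<close>. It cannot be demanded at every \<open>L\<close>: over an
  infinite domain, a structure may make infinitely many instances of an atom true, and then no
  finite set of substitutions describes them.
\<close>

definition sat_spec ::
    "('f, 'v, 'o, 's) signature \<Rightarrow> ('f, 'v, 'o, 's) sat_fun \<Rightarrow> ('f, 'v, 'o, 's) struct \<Rightarrow> bool" where
  "sat_spec \<Sigma> sat L \<longleftrightarrow>
    (\<forall>P. if objective P \<and> (\<forall>t\<in>in_args \<Sigma> P. ground t)
      then \<exists>X. sat L P = Some X \<and> finite X \<and>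
        (\<forall>\<sigma>\<in>X. is_subst \<Sigma> \<sigma> \<and> (\<Union>t\<in>out_args \<Sigma> P. fv_trm t) \<subseteq> dom \<sigma>) \<and>
        (\<forall>\<sigma>'. is_subst \<Sigma> \<sigma>' \<and> fv_atom P \<subseteq> dom \<sigma>' \<longrightarrow>
          (models \<Sigma> L (Atom (subst_atom \<sigma>' P)) \<longleftrightarrow> (\<exists>\<sigma>\<in>X. \<sigma> \<subseteq>\<^sub>m \<sigma>')))
      else sat L P = None) \<and>
    (\<forall>ts S. fv_trms ts = {} \<longrightarrow>
      sat L (NotIn ts S) = Some (if ts |\<notin>| S then {Map.empty} else {}))"

text \<open>\<open>sat_hat sat L c X\<close>: the value of \<open>sat\<close>, lifted to restrictions, at \<open>c\<close> is defined and equals \<open>X\<close>.\<close>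

inductive sat_hat ::
    "('f, 'v, 'o, 's) sat_fun \<Rightarrow> ('f, 'v, 'o, 's) struct \<Rightarrow> ('f, 'v, 'o) restr \<Rightarrow>
     ('f, 'v) subst set \<Rightarrow> bool"
  for sat L where
  pred: "sat L (Obj p ts) = Some X \<Longrightarrow> sat_hat sat L (RPred p ts) X"
| notin: "sat L (NotIn ts S) = Some X \<Longrightarrow> sat_hat sat L (RNotIn ts S) X"
| top: "sat_hat sat L RTop {Map.empty}"
| bot: "sat_hat sat L RBot {}"
| conj: "sat_hat sat L c1 X1 \<Longrightarrow>
    \<forall>\<sigma>1\<in>X1. sat_hat sat L (subst_restr \<sigma>1 c2) (X2 \<sigma>1) \<Longrightarrow>
    \<forall>\<sigma>1\<in>X1. \<forall>\<sigma>2\<in>X2 \<sigma>1. compatible \<sigma>1 \<sigma>2 \<Longrightarrow>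
    sat_hat sat L (RAnd c1 c2) (\<Union>\<sigma>1\<in>X1. {\<sigma>1 ++ \<sigma>2 | \<sigma>2. \<sigma>2 \<in> X2 \<sigma>1})"
| disj: "sat_hat sat L c1 X1 \<Longrightarrow> sat_hat sat L c2 X2 \<Longrightarrow> sat_hat sat L (ROr c1 c2) (X1 \<union> X2)"
| ex: "sat_hat sat L c X \<Longrightarrow> sat_hat sat L (REx x c) {\<sigma>(x := None) | \<sigma>. \<sigma> \<in> X}"


section \<open>Reduction\<close>

text \<open>\<open>inst xs \<sigma>\<close> is the tuple \<open>\<sigma>(xs)\<close>, meaningful only if \<open>set xs \<subseteq> dom \<sigma>\<close>.\<close>

definition inst :: "'v list \<Rightarrow> ('f, 'v) subst \<Rightarrow> ('f, 'v) trm list" where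
  "inst xs \<sigma> = map (\<lambda>x. the (\<sigma> x)) xs"

text \<open>
  \<open>reduce sat L \<phi> \<psi>\<close>: the value at \<open>\<phi>\<close> is defined and equals \<open>\<psi>\<close>. It is a relation because the
  order in which the finite set of substitutions is enumerated, and hence the order of the
  conjuncts or disjuncts of \<open>\<psi>\<close>, is arbitrary.
\<close>

inductive reduce ::
    "('f, 'v, 'o, 's) sat_fun \<Rightarrow> ('f, 'v, 'o, 's) struct \<Rightarrow> ('f, 'v, 'o, 's) fm \<Rightarrow>
     ('f, 'v, 'o, 's) fm \<Rightarrow> bool"
  for sat L where
  atom: "ground_atom P \<Longrightarrow>
    reduce sat L (Atom P) (case L P of TT \<Rightarrow> Top | FF \<Rightarrow> Bot | UU \<Rightarrow> Atom P)"
| top: "reduce sat L Top Top"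
| bot: "reduce sat L Bot Bot"
| conj: "reduce sat L \<phi>1 \<psi>1 \<Longrightarrow> reduce sat L \<phi>2 \<psi>2 \<Longrightarrow> reduce sat L (And \<phi>1 \<phi>2) (And \<psi>1 \<psi>2)"
| disj: "reduce sat L \<phi>1 \<psi>1 \<Longrightarrow> reduce sat L \<phi>2 \<psi>2 \<Longrightarrow> reduce sat L (Or \<phi>1 \<phi>2) (Or \<psi>1 \<psi>2)"
| all: "sat_hat sat L c (set \<sigma>s) \<Longrightarrow> distinct \<sigma>s \<Longrightarrow> \<forall>\<sigma>\<in>set \<sigma>s. set xs \<subseteq> dom \<sigma> \<Longrightarrow>
    list_all2 (\<lambda>\<sigma> \<psi>. reduce sat L (subst_fm [xs [\<mapsto>] inst xs \<sigma>] \<phi>) \<psi>) \<sigma>s \<psi>s \<Longrightarrow>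
    S = fset_of_list (map (inst xs) \<sigma>s) \<Longrightarrow>
    reduce sat L (All xs c \<phi>)
      (foldr And \<psi>s (All xs (RAnd c (RNotIn (map Var xs) S)) \<phi>))"
| ex: "sat_hat sat L c (set \<sigma>s) \<Longrightarrow> distinct \<sigma>s \<Longrightarrow> \<forall>\<sigma>\<in>set \<sigma>s. set xs \<subseteq> dom \<sigma> \<Longrightarrow>
    list_all2 (\<lambda>\<sigma> \<psi>. reduce sat L (subst_fm [xs [\<mapsto>] inst xs \<sigma>] \<phi>) \<psi>) \<sigma>s \<psi>s \<Longrightarrow>
    S = fset_of_list (map (inst xs) \<sigma>s) \<Longrightarrow>
    reduce sat L (Ex xs c \<phi>)
      (foldr Or \<psi>s (Ex xs (RAnd c (RNotIn (map Var xs) S)) \<phi>))"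

end

theory Submission
  imports Defs
begin

text \<open>
  Only the soundness half of \<open>sat\<close> is needed: every tuple it returns for \<open>c\<close> satisfies \<open>c\<close> in \<open>L\<close>,
  hence in every extension \<open>L'\<close>, where the dual of \<open>c\<close> then fails. So at these tuples the quantified
  formula is equivalent to its body, which the induction hypothesis covers; at all other tuples the
  added restriction \<open>xs \<notin> S\<close> is vacuous.
\<close>

section \<open>Substitution\<close>

abbreviation ground_subst :: "('f, 'v) subst \<Rightarrow> bool" where
  "ground_subst \<sigma> \<equiv> (\<forall>t\<in>ran \<sigma>. ground t)"

lemma ground_subst_upd_None: "ground_subst \<sigma> \<Longrightarrow> ground_subst (\<sigma>(x := None))"
  by (auto simp: ran_def split: if_splits)

lemma ground_subst_restrict: "ground_subst \<sigma> \<Longrightarrow> ground_subst (\<sigma> |` A)"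
  by (auto simp: ran_def restrict_map_def split: if_splits)

lemma ran_map_upds_subset: "ran [xs [\<mapsto>] ts] \<subseteq> set ts"
  by (auto simp: map_upds_def ran_def dest!: map_of_SomeD set_zip_rightD)

lemma subst_trm_ground: "ground t \<Longrightarrow> subst_trm \<sigma> t = t"
  by (induction t) (auto intro: map_idI)

text \<open>Ground values of \<sigma> are left alone by \<tau>, so \<tau> acts only on variables
  that \<sigma> does not bind. Composition is therefore \<open>++\<close> with \<sigma> taking
  precedence.\<close>

lemma subst_trm_subst_trm:
  "ground_subst \<sigma> \<Longrightarrow> subst_trm \<tau> (subst_trm \<sigma> t) = subst_trm (\<tau> ++ \<sigma>) t"
  by (induction t) (auto simp: ran_def subst_trm_ground map_add_def split: option.splits)

lemma subst_restr_subst_restr: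
  "ground_subst \<sigma> \<Longrightarrow> subst_restr \<tau> (subst_restr \<sigma> c) = subst_restr (\<tau> ++ \<sigma>) c"
proof (induction c arbitrary: \<sigma> \<tau>)
  case (REx x c)
  \<comment> \<open>Under the binder both substitutions lose \<open>x\<close>. This removal commutes
    with \<open>++\<close>, so the induction hypothesis applies to the two reduced maps.\<close>
  have eq: "\<tau>(x := None) ++ \<sigma>(x := None) = (\<tau> ++ \<sigma>)(x := None)"
    by (rule ext) (auto simp: map_add_def split: option.split)
  show ?case
    unfolding subst_restr.simps eq[symmetric]
    by (simp only: REx.IH[OF ground_subst_upd_None[OF REx.prems]])
qed (auto simp: subst_trm_subst_trm)

lemma subst_trm_cong: "(\<And>x. x \<in> fv_trm t \<Longrightarrow> \<sigma> x = \<tau> x) \<Longrightarrow> subst_trm \<sigma> t = subst_trm \<tau> t"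
  by (induction t) (auto split: option.splits)

lemma subst_restr_cong:
  "(\<And>x. x \<in> fv_restr c \<Longrightarrow> \<sigma> x = \<tau> x) \<Longrightarrow> subst_restr \<sigma> c = subst_restr \<tau> c"
proof (induction c arbitrary: \<sigma> \<tau>)
  case (RAnd c d)
  show ?case using RAnd.IH[of \<sigma> \<tau>] RAnd.prems by simp
next
  case (ROr c d)
  show ?case using ROr.IH[of \<sigma> \<tau>] ROr.prems by simp
next
  case (REx x c)
  have "subst_restr (\<sigma>(x := None)) c = subst_restr (\<tau>(x := None)) c"
    by (rule REx.IH) (use REx.prems in auto)
  then show ?case by simp
qed (auto intro!: subst_trm_cong)

section \<open>Free variables and well-formedness under substitution\<close>

lemma fv_subst_trm: "ground_subst \<sigma> \<Longrightarrow> fv_trm (subst_trm \<sigma> t) = fv_trm t - dom \<sigma>"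
  by (induction t) (auto simp: ran_def split: option.splits)

lemma fv_subst_restr: "ground_subst \<sigma> \<Longrightarrow> fv_restr (subst_restr \<sigma> c) = fv_restr c - dom \<sigma>"
  by (induction c arbitrary: \<sigma>) (auto simp: fv_subst_trm ground_subst_upd_None split: if_splits)

lemma fv_subst_atom: "ground_subst \<sigma> \<Longrightarrow> fv_atom (subst_atom \<sigma> P) = fv_atom P - dom \<sigma>"
  by (cases P) (auto simp: fv_subst_trm)

lemma fv_subst_fm: "ground_subst \<sigma> \<Longrightarrow> fv_fm (subst_fm \<sigma> \<phi>) = fv_fm \<phi> - dom \<sigma>"
  by (induction \<phi> arbitrary: \<sigma>)
    (auto simp: fv_subst_atom fv_subst_restr ground_subst_restrict)

lemma wf_subst_restr: "wf_restr c \<Longrightarrow> wf_restr (subst_restr \<sigma> c)"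
  by (induction c arbitrary: \<sigma>) auto

lemma wf_subst_atom: "wf_atom P \<Longrightarrow> wf_atom (subst_atom \<sigma> P)"
  by (cases P) auto

lemma wf_subst_fm: "wf_fm \<phi> \<Longrightarrow> wf_fm (subst_fm \<sigma> \<phi>)"
  by (induction \<phi> arbitrary: \<sigma>) (auto simp: wf_subst_restr wf_subst_atom)

lemma subst_dual_restr: "subst_fm \<sigma> (dual_restr \<Sigma> c) = dual_restr \<Sigma> (subst_restr \<sigma> c)"
proof (induction c arbitrary: \<sigma>)
  case (REx x c)
  \<comment> \<open>The dual of \<open>REx x\<close> is \<open>All [x] RTop\<close>, and the two
    binders remove the bound variable by different operations, which coincide for one
    variable.\<close>
  have "\<sigma> |` (- set [x]) = \<sigma>(x := None)"
    by (auto simp: restrict_map_def)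
  with REx show ?case
    by (simp only: subst_restr.simps dual_restr.simps subst_fm.simps)
qed auto

lemma subst_dual: "subst_fm \<sigma> (dual \<Sigma> \<phi>) = dual \<Sigma> (subst_fm \<sigma> \<phi>)"
proof (induction \<phi> arbitrary: \<sigma>)
  case (Atom P)
  show ?case by (cases P) auto
qed auto

section \<open>Tuples read as substitutions\<close>

lemma map_upds_nth:
  "distinct xs \<Longrightarrow> length ts = length xs \<Longrightarrow> i < length xs \<Longrightarrow>
    (m(xs [\<mapsto>] ts)) (xs ! i) = Some (ts ! i)"
\<comment> \<open>The map \<open>m\<close> is general because the first pair updates it;
  distinctness keeps the later pairs from overriding that entry.\<close>
proof (induction xs arbitrary: m ts i)
  case (Cons x xs)
  then obtain t us where "ts = t # us" by (cases ts) auto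
  with Cons show ?case by (cases i) auto
qed simp

text \<open>Allows the substitution built from the tuple \<sigma>(xs) to be exchanged for \<sigma>
  itself in a restriction whose free variables all lie in \<open>xs\<close>.\<close>

lemma map_upds_inst:
  "distinct xs \<Longrightarrow> set xs \<subseteq> dom \<sigma> \<Longrightarrow> x \<in> set xs \<Longrightarrow> [xs [\<mapsto>] inst xs \<sigma>] x = \<sigma> x"
  by (auto simp: in_set_conv_nth map_upds_nth inst_def domIff subset_iff)

lemma map_subst_map_upds:
  "distinct xs \<Longrightarrow> length ts = length xs \<Longrightarrow>
    map (subst_trm [xs [\<mapsto>] ts]) (map Var xs) = ts"
  by (auto intro!: nth_equalityI simp: map_upds_nth)

lemma set_inst_subset_ran: "set xs \<subseteq> dom \<sigma> \<Longrightarrow> set (inst xs \<sigma>) \<subseteq> ran \<sigma>"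
  by (force simp: inst_def ran_def)

lemma is_subst_ground: "wf_signature \<Sigma> \<Longrightarrow> is_subst \<Sigma> \<sigma> \<Longrightarrow> ground_subst \<sigma>"
  by (auto simp: is_subst_def wf_signature_def)

section \<open>Soundness of sat\<close>

lemma sat_sound:
  assumes "sat_spec \<Sigma> sat L" "sat L P = Some X" "\<sigma> \<in> X"
  shows "is_subst \<Sigma> \<sigma>"
    and "is_subst \<Sigma> \<sigma>' \<Longrightarrow> fv_atom P \<subseteq> dom \<sigma>' \<Longrightarrow> \<sigma> \<subseteq>\<^sub>m \<sigma>' \<Longrightarrow> L (subst_atom \<sigma>' P) = TT"
proof -
  \<comment> \<open>This is the clause of the specification for the single atom \<open>P\<close>. As
    \<open>sat L P\<close> has a value, the \<open>else\<close> branch is excluded.\<close>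
  have *: "if objective P \<and> (\<forall>t\<in>in_args \<Sigma> P. ground t)
      then \<exists>X. sat L P = Some X \<and> finite X \<and>
        (\<forall>\<sigma>\<in>X. is_subst \<Sigma> \<sigma> \<and> (\<Union>t\<in>out_args \<Sigma> P. fv_trm t) \<subseteq> dom \<sigma>) \<and>
        (\<forall>\<sigma>'. is_subst \<Sigma> \<sigma>' \<and> fv_atom P \<subseteq> dom \<sigma>' \<longrightarrow>
          (models \<Sigma> L (Atom (subst_atom \<sigma>' P)) \<longleftrightarrow> (\<exists>\<sigma>\<in>X. \<sigma> \<subseteq>\<^sub>m \<sigma>')))
      else sat L P = None"
    using assms(1) unfolding sat_spec_def by blast
  show "is_subst \<Sigma> \<sigma>"
    using * assms(2,3) by (auto split: if_splits)
  show "L (subst_atom \<sigma>' P) = TT" if "is_subst \<Sigma> \<sigma>'" "fv_atom P \<subseteq> dom \<sigma>'" "\<sigma> \<subseteq>\<^sub>m \<sigma>'"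
    using * assms(2,3) that by (auto split: if_splits)
qed

text \<open>Truth is claimed at every \<sigma>' above \<sigma> that covers the free variables, since
  a substitution found for one part of \<open>c\<close> need not bind the variables of the other
  parts. In a conjunction or disjunction the hypotheses can then be applied to one common
  \<sigma>'.\<close>

lemma sat_hat_sound:
  assumes "sat_hat sat L c X" "wf_signature \<Sigma>" "sat_spec \<Sigma> sat L" "\<sigma> \<in> X"
  shows "is_subst \<Sigma> \<sigma> \<and>
    (\<forall>\<sigma>'. is_subst \<Sigma> \<sigma>' \<and> fv_restr c \<subseteq> dom \<sigma>' \<and> \<sigma> \<subseteq>\<^sub>m \<sigma>' \<longrightarrow>
      models_restr \<Sigma> L (subst_restr \<sigma>' c))"
  using assms(1,4)
proof (induction arbitrary: \<sigma> rule: sat_hat.induct)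
  case (pred p ts X)
  show ?case
    using sat_sound[OF assms(3) pred(1,2)] by auto
next
  case (notin ts S X)
  show ?case
    using sat_sound[OF assms(3) notin(1,2)] by auto
next
  case top
  then show ?case by (auto simp: is_subst_def)
next
  case bot
  then show ?case by simp
next
  case (conj c1 X1 c2 X2)
  then obtain \<sigma>1 \<sigma>2 where \<sigma>: "\<sigma>1 \<in> X1" "\<sigma>2 \<in> X2 \<sigma>1" "\<sigma> = \<sigma>1 ++ \<sigma>2" by auto
  have comp: "compatible \<sigma>1 \<sigma>2" using conj.hyps \<sigma> by blast
  have 1: "is_subst \<Sigma> \<sigma>1"
    and m1: "\<And>\<sigma>'. is_subst \<Sigma> \<sigma>' \<Longrightarrow> fv_restr c1 \<subseteq> dom \<sigma>' \<Longrightarrow> \<sigma>1 \<subseteq>\<^sub>m \<sigma>' \<Longrightarrow>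
      models_restr \<Sigma> L (subst_restr \<sigma>' c1)"
    using conj.IH(1)[OF \<sigma>(1)] by auto
  have 2: "is_subst \<Sigma> \<sigma>2"
    and m2: "\<And>\<sigma>'. is_subst \<Sigma> \<sigma>' \<Longrightarrow> fv_restr (subst_restr \<sigma>1 c2) \<subseteq> dom \<sigma>' \<Longrightarrow> \<sigma>2 \<subseteq>\<^sub>m \<sigma>' \<Longrightarrow>
      models_restr \<Sigma> L (subst_restr \<sigma>' (subst_restr \<sigma>1 c2))"
    using conj.IH(2) \<sigma>(1,2) by blast+
  have g1: "ground_subst \<sigma>1" using is_subst_ground[OF assms(2) 1] .
  have "is_subst \<Sigma> \<sigma>"
    using 1 2 unfolding \<sigma> is_subst_def by (auto simp: ran_def)
  moreover have "models_restr \<Sigma> L (subst_restr \<sigma>' (RAnd c1 c2))"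
    if \<sigma>': "is_subst \<Sigma> \<sigma>'" "fv_restr (RAnd c1 c2) \<subseteq> dom \<sigma>'" "\<sigma> \<subseteq>\<^sub>m \<sigma>'" for \<sigma>'
  proof -
    have le2: "\<sigma>2 \<subseteq>\<^sub>m \<sigma>'"
      using map_le_trans[OF map_le_map_add] \<sigma>'(3) unfolding \<sigma> .
    \<comment> \<open>In \<open>\<sigma>1 ++ \<sigma>2\<close> the second map wins on common
      variables, so it takes compatibility to place \<sigma>1 below \<sigma>'.\<close>
    have "\<sigma>1 x = \<sigma>' x" if "x \<in> dom \<sigma>1" for x
    proof -
      have "(\<sigma>1 ++ \<sigma>2) x = \<sigma>1 x"
      proof (cases "x \<in> dom \<sigma>2")
        case True
        then have "\<sigma>1 x = \<sigma>2 x" using comp that unfolding compatible_def by blast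
        with True show ?thesis by (simp add: map_add_dom_app_simps(1))
      next
        case False
        then show ?thesis by (simp add: map_add_dom_app_simps(3))
      qed
      moreover have "(\<sigma>1 ++ \<sigma>2) x = \<sigma>' x"
        using \<sigma>'(3) that unfolding \<sigma> map_le_def by simp
      ultimately show ?thesis by simp
    qed
    hence le1: "\<sigma>1 \<subseteq>\<^sub>m \<sigma>'" by (simp add: map_le_def)
    \<comment> \<open>Since \<sigma>' already contains \<sigma>1, applying \<sigma>1 and then
      \<sigma>' is the same as applying \<sigma>'. This turns the hypothesis about the instance of
      \<open>c2\<close> under \<sigma>1 into one about \<open>c2\<close>.\<close>
    hence "\<sigma>' ++ \<sigma>1 = \<sigma>'"
      by (metis map_add_le_mapI map_le_antisym map_le_map_add map_le_refl map_le_iff_map_add_commute)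
    hence eq: "subst_restr \<sigma>' (subst_restr \<sigma>1 c2) = subst_restr \<sigma>' c2"
      using subst_restr_subst_restr[OF g1, of \<sigma>' c2] by simp
    have "fv_restr (subst_restr \<sigma>1 c2) \<subseteq> dom \<sigma>'"
      using \<sigma>'(2) fv_subst_restr[OF g1, of c2] by auto
    from m2[OF \<sigma>'(1) this le2] m1[OF \<sigma>'(1) _ le1] \<sigma>'(2) eq show ?thesis by simp
  qed
  ultimately show ?case by blast
next
  case (disj c1 X1 c2 X2)
  then show ?case by auto
next
  case (ex c X x)
  then obtain \<tau> where \<tau>: "\<tau> \<in> X" "\<sigma> = \<tau>(x := None)" by auto
  have t: "is_subst \<Sigma> \<tau>"
    and m: "\<And>\<sigma>'. is_subst \<Sigma> \<sigma>' \<Longrightarrow> fv_restr c \<subseteq> dom \<sigma>' \<Longrightarrow> \<tau> \<subseteq>\<^sub>m \<sigma>' \<Longrightarrow>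
      models_restr \<Sigma> L (subst_restr \<sigma>' c)"
    using ex.IH[OF \<tau>(1)] by auto
  have "is_subst \<Sigma> \<sigma>"
    using t unfolding \<tau> is_subst_def by (auto simp: ran_def split: if_splits)
  moreover have "models_restr \<Sigma> L (subst_restr \<sigma>' (REx x c))"
    if \<sigma>': "is_subst \<Sigma> \<sigma>'" "fv_restr (REx x c) \<subseteq> dom \<sigma>'" "\<sigma> \<subseteq>\<^sub>m \<sigma>'" for \<sigma>'
  proof -
    \<comment> \<open>The witness for the bound variable is the value that \<tau> gives to
      \<open>x\<close>, or any element of the nonempty domain if \<tau> leaves \<open>x\<close>
      unbound. Updating \<sigma>' at \<open>x\<close> discards any unrelated value it has
      there.\<close>
    obtain t where td: "t \<in> domain \<Sigma>" and tx: "\<tau> x = None \<or> \<tau> x = Some t"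
    proof (cases "\<tau> x")
      case None
      then show ?thesis using that assms(2) by (auto simp: wf_signature_def)
    next
      case (Some t)
      then show ?thesis using that t by (auto simp: is_subst_def ran_def)
    qed
    have "is_subst \<Sigma> (\<sigma>'(x \<mapsto> t))"
      using \<sigma>'(1) td by (auto simp: is_subst_def ran_def)
    moreover have "fv_restr c \<subseteq> dom (\<sigma>'(x \<mapsto> t))" using \<sigma>'(2) by auto
    moreover have "\<tau> \<subseteq>\<^sub>m \<sigma>'(x \<mapsto> t)"
      using \<sigma>'(3) tx unfolding \<tau> map_le_def by auto
    ultimately have "models_restr \<Sigma> L (subst_restr (\<sigma>'(x \<mapsto> t)) c)" by (rule m)
    moreover have "subst_restr [x \<mapsto> t] (subst_restr (\<sigma>'(x := None)) c) = subst_restr (\<sigma>'(x \<mapsto> t)) c"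
    proof -
      have "[x \<mapsto> t] ++ \<sigma>'(x := None) = \<sigma>'(x \<mapsto> t)"
        by (auto simp: map_add_def split: option.splits)
      then show ?thesis
        using subst_restr_subst_restr ground_subst_upd_None is_subst_ground[OF assms(2) \<sigma>'(1)]
        by metis
    qed
    ultimately show ?thesis using td unfolding subst_restr.simps models_restr.simps by metis
  qed
  ultimately show ?case by blast
qed

text \<open>Soundness at \<sigma>' = \<sigma>, which covers \<open>c\<close> because its free
  variables lie in \<open>xs\<close>, followed by passing from \<sigma> to the tuple it
  determines.\<close>

lemma sat_hat_models_restr:
  assumes "wf_signature \<Sigma>" "sat_spec \<Sigma> sat L" "sat_hat sat L c X" "\<sigma> \<in> X"
    and "distinct xs" "set xs \<subseteq> dom \<sigma>" "fv_restr c \<subseteq> set xs"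
  shows "models_restr \<Sigma> L (subst_restr [xs [\<mapsto>] inst xs \<sigma>] c)"
proof -
  have "models_restr \<Sigma> L (subst_restr \<sigma> c)"
    using sat_hat_sound[OF assms(3,1,2,4)] assms(6,7) by auto
  moreover have "subst_restr [xs [\<mapsto>] inst xs \<sigma>] c = subst_restr \<sigma> c"
    using assms(5-7) by (auto intro!: subst_restr_cong map_upds_inst)
  ultimately show ?thesis by simp
qed

section \<open>Restrictions in extensions\<close>

lemma ground_subst_domain: "wf_signature \<Sigma> \<Longrightarrow> set ts \<subseteq> domain \<Sigma> \<Longrightarrow> ground_subst [xs [\<mapsto>] ts]"
  using ran_map_upds_subset[of xs ts] by (auto simp: wf_signature_def)

lemma fv_subst_restr_single:
  "wf_signature \<Sigma> \<Longrightarrow> t \<in> domain \<Sigma> \<Longrightarrow> fv_restr (subst_restr [x \<mapsto> t] c) = fv_restr c - {x}"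
  by (subst fv_subst_restr) (auto simp: wf_signature_def)

text \<open>Restrictions are positive: their truth is built from true atoms by conjunction,
  disjunction and existential choice, and true ground atoms stay true in an extension. The induction
  is on size because the quantifier case passes to an instance, which is not a subterm.\<close>

lemma models_restr_extends:
  assumes "wf_signature \<Sigma>" "extends L' L"
  shows "models_restr \<Sigma> L c \<Longrightarrow> fv_restr c = {} \<Longrightarrow> models_restr \<Sigma> L' c"
proof (induction c rule: measure_induct_rule[of rsize])
  case (less c)
  show ?case
  proof (cases c)
    case (RPred p ts)
    then show ?thesis using less.prems assms(2) by (auto simp: extends_def)
  next
    case (RNotIn ts S)
    then show ?thesis using less.prems assms(2) by (auto simp: extends_def)
  next
    case (REx x d)
    then obtain t where t: "t \<in> domain \<Sigma>" "models_restr \<Sigma> L (subst_restr [x \<mapsto> t] d)"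
      using less.prems by auto
    have "models_restr \<Sigma> L' (subst_restr [x \<mapsto> t] d)"
      using less.IH[OF _ t(2)] less.prems REx fv_subst_restr_single[OF assms(1) t(1)] by auto
    with REx t show ?thesis by auto
  qed (use less in auto)
qed

text \<open>A ground atom of value \<open>TT\<close> has a dual of value \<open>FF\<close>, and this
  exclusion propagates through the connectives. The converse can fail: at an atom of value
  \<open>UU\<close> neither it nor its dual is true.\<close>

lemma models_restr_consistent:
  assumes "wf_signature \<Sigma>" "partial_structure \<Sigma> L"
  shows "models_restr \<Sigma> L c \<Longrightarrow> fv_restr c = {} \<Longrightarrow> \<not> models \<Sigma> L (dual_restr \<Sigma> c)"
proof (induction c rule: measure_induct_rule[of rsize])
  case (less c)
  have dual: "ground_atom P \<Longrightarrow> L (dual_atom \<Sigma> P) = dual_tv (L P)" for P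
    using assms(2) by (auto simp: partial_structure_def)
  show ?case
  proof (cases c)
    case (RPred p ts)
    then show ?thesis using less.prems dual[of "Obj p ts"] by auto
  next
    case (RNotIn ts S)
    then show ?thesis using less.prems dual[of "NotIn ts S"] by auto
  next
    case (REx x d)
    then obtain t where t: "t \<in> domain \<Sigma>" "models_restr \<Sigma> L (subst_restr [x \<mapsto> t] d)"
      using less.prems by auto
    have "\<not> models \<Sigma> L (dual_restr \<Sigma> (subst_restr [x \<mapsto> t] d))"
      using less.IH[OF _ t(2)] less.prems REx fv_subst_restr_single[OF assms(1) t(1)] by auto
    hence "\<not> models \<Sigma> L (subst_fm [[x] [\<mapsto>] [t]] (dual_restr \<Sigma> d))"
      by (simp add: subst_dual_restr)
    \<comment> \<open>The guard \<open>RTop\<close> has dual \<open>Bot\<close>, so the universal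
      dual would need its body to hold at the one-element tuple \<open>[t]\<close>.\<close>
    with REx t show ?thesis by (auto intro!: exI[of _ "[t]"])
  qed (use less in auto)
qed

section \<open>Reduction\<close>

lemma models_foldr_And:
  "models \<Sigma> L (foldr And \<psi>s \<chi>) \<longleftrightarrow> (\<forall>\<psi>\<in>set \<psi>s. models \<Sigma> L \<psi>) \<and> models \<Sigma> L \<chi>"
  by (induction \<psi>s) simp_all

lemma models_foldr_Or:
  "models \<Sigma> L (foldr Or \<psi>s \<chi>) \<longleftrightarrow> (\<exists>\<psi>\<in>set \<psi>s. models \<Sigma> L \<psi>) \<or> models \<Sigma> L \<chi>"
  by (induction \<psi>s) simp_all

lemma dual_foldr_And: "dual \<Sigma> (foldr And \<psi>s \<chi>) = foldr Or (map (dual \<Sigma>) \<psi>s) (dual \<Sigma> \<chi>)"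
  by (induction \<psi>s) simp_all

lemma dual_foldr_Or: "dual \<Sigma> (foldr Or \<psi>s \<chi>) = foldr And (map (dual \<Sigma>) \<psi>s) (dual \<Sigma> \<chi>)"
  by (induction \<psi>s) simp_all

text \<open>Membership atoms are never \<open>UU\<close> on ground tuples, so the added restriction
  and its dual are exact complements.\<close>

lemma models_NotIn_vars:
  assumes "wf_signature \<Sigma>" "partial_structure \<Sigma> L"
    and "distinct xs" "length ts = length xs" "set ts \<subseteq> domain \<Sigma>"
  shows "models_restr \<Sigma> L (subst_restr [xs [\<mapsto>] ts] (RNotIn (map Var xs) S)) \<longleftrightarrow> ts |\<notin>| S"
    and "models \<Sigma> L (dual_restr \<Sigma> (subst_restr [xs [\<mapsto>] ts] (RNotIn (map Var xs) S))) \<longleftrightarrow> ts |\<in>| S"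
proof -
  have g: "ground_atom (NotIn ts S :: ('a, 'b, 'c, 'd) atom)"
    using assms(1,5) by (auto simp: wf_signature_def)
  hence "L (NotIn ts S) = (if ts |\<notin>| S then TT else FF)"
    and "L (In ts S) = dual_tv (L (NotIn ts S))"
    using assms(2) unfolding partial_structure_def by (blast, metis dual_atom.simps(3))
  then show "models_restr \<Sigma> L (subst_restr [xs [\<mapsto>] ts] (RNotIn (map Var xs) S)) \<longleftrightarrow> ts |\<notin>| S"
    and "models \<Sigma> L (dual_restr \<Sigma> (subst_restr [xs [\<mapsto>] ts] (RNotIn (map Var xs) S))) \<longleftrightarrow> ts |\<in>| S"
    using map_subst_map_upds[OF assms(3,4)] by (simp_all del: map_map)
qed

text \<open>The set \<open>S\<close> may be any finite set of tuples satisfying \<open>c\<close>; it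
  need not contain all of them. Excluding \<open>S\<close> from the range loses exactly the
  instances at \<open>S\<close>, where the guard holds and only the body remains to be
  decided.\<close>

lemma models_quantifier_split:
  assumes "wf_signature \<Sigma>" "partial_structure \<Sigma> L" "distinct xs"
    and S: "\<forall>ts\<in>fset S. length ts = length xs \<and> set ts \<subseteq> domain \<Sigma> \<and>
      fv_restr (subst_restr [xs [\<mapsto>] ts] c) = {} \<and> models_restr \<Sigma> L (subst_restr [xs [\<mapsto>] ts] c)"
  shows "models \<Sigma> L (All xs c \<phi>) \<longleftrightarrow> (\<forall>ts\<in>fset S. models \<Sigma> L (subst_fm [xs [\<mapsto>] ts] \<phi>)) \<and>
      models \<Sigma> L (All xs (RAnd c (RNotIn (map Var xs) S)) \<phi>)" (is ?all)
    and "models \<Sigma> L (Ex xs c \<phi>) \<longleftrightarrow> (\<exists>ts\<in>fset S. models \<Sigma> L (subst_fm [xs [\<mapsto>] ts] \<phi>)) \<or>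
      models \<Sigma> L (Ex xs (RAnd c (RNotIn (map Var xs) S)) \<phi>)" (is ?ex)
proof -
  \<comment> \<open>Needed for the universal split: at a tuple of \<open>S\<close> the disjunct
    given by the dual of \<open>c\<close> must fail, so that the body is forced.\<close>
  have S': "\<not> models \<Sigma> L (dual_restr \<Sigma> (subst_restr [xs [\<mapsto>] ts] c))" if "ts |\<in>| S" for ts
    using bspec[OF S that] models_restr_consistent[OF assms(1,2)] by blast
  note notin = models_NotIn_vars[OF assms(1-3)]
  have "models \<Sigma> L (All xs (RAnd c (RNotIn (map Var xs) S)) \<phi>) \<longleftrightarrow>
    (\<forall>ts. length ts = length xs \<and> set ts \<subseteq> domain \<Sigma> \<longrightarrow>
      models \<Sigma> L (dual_restr \<Sigma> (subst_restr [xs [\<mapsto>] ts] c)) \<or> ts |\<in>| S \<or>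
      models \<Sigma> L (subst_fm [xs [\<mapsto>] ts] \<phi>))"
    by (simp add: subst_dual_restr notin(2) del: subst_restr.simps(2) dual_restr.simps(2))
  then show ?all
    using S S' unfolding models.simps(6) subst_dual_restr by metis
  have "models \<Sigma> L (Ex xs (RAnd c (RNotIn (map Var xs) S)) \<phi>) \<longleftrightarrow>
    (\<exists>ts. length ts = length xs \<and> set ts \<subseteq> domain \<Sigma> \<and>
      models_restr \<Sigma> L (subst_restr [xs [\<mapsto>] ts] c) \<and> ts |\<notin>| S \<and>
      models \<Sigma> L (subst_fm [xs [\<mapsto>] ts] \<phi>))"
    by (simp add: notin(1) conj_assoc del: subst_restr.simps(2) models_restr.simps(2) cong: conj_cong)
  then show ?ex
    using S unfolding models.simps(7) by metis
qed

text \<open>Supplies the conditions that the quantifier split puts on \<open>S\<close>. The tuples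
  are computed at \<open>L\<close>, while truth is needed at \<open>L'\<close>; it transfers because
  substituting ground tuples closes \<open>c\<close>.\<close>

lemma fset_of_list_inst_properties:
  assumes "wf_signature \<Sigma>" "sat_spec \<Sigma> sat L" "extends L' L"
    and "sat_hat sat L c (set \<sigma>s)" "\<forall>\<sigma>\<in>set \<sigma>s. set xs \<subseteq> dom \<sigma>"
    and "distinct xs" "fv_restr c \<subseteq> set xs" "ts |\<in>| fset_of_list (map (inst xs) \<sigma>s)"
  shows "length ts = length xs" "set ts \<subseteq> domain \<Sigma>"
    "fv_restr (subst_restr [xs [\<mapsto>] ts] c) = {}" "models_restr \<Sigma> L' (subst_restr [xs [\<mapsto>] ts] c)"
proof -
  obtain \<sigma> where \<sigma>: "\<sigma> \<in> set \<sigma>s" "ts = inst xs \<sigma>"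
    using assms(8) by (auto simp: fset_of_list_elem)
  show len: "length ts = length xs" by (simp add: \<sigma> inst_def)
  have "is_subst \<Sigma> \<sigma>" using sat_hat_sound[OF assms(4,1,2) \<sigma>(1)] by blast
  then show dom: "set ts \<subseteq> domain \<Sigma>"
    using set_inst_subset_ran[of xs \<sigma>] assms(5) \<sigma> by (auto simp: is_subst_def)
  show closed: "fv_restr (subst_restr [xs [\<mapsto>] ts] c) = {}"
    using fv_subst_restr[OF ground_subst_domain[OF assms(1) dom], of xs c] len assms(7) by auto
  have "models_restr \<Sigma> L (subst_restr [xs [\<mapsto>] ts] c)"
    using sat_hat_models_restr[OF assms(1,2,4) \<sigma>(1) assms(6) _ assms(7)] assms(5) \<sigma> by auto
  then show "models_restr \<Sigma> L' (subst_restr [xs [\<mapsto>] ts] c)"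
    using models_restr_extends[OF assms(1,3)] closed by blast
qed

text \<open>One induction handles both equivalences. The second is not the negation of the first,
  since a formula and its dual may both fail in a partial structure.\<close>

definition equiv_dual ::
    "('f, 'v, 'o, 's) signature \<Rightarrow> ('f, 'v, 'o, 's) struct \<Rightarrow> ('f, 'v, 'o, 's) fm \<Rightarrow>
     ('f, 'v, 'o, 's) fm \<Rightarrow> bool" where
  "equiv_dual \<Sigma> L \<phi> \<psi> \<longleftrightarrow> (models \<Sigma> L \<phi> \<longleftrightarrow> models \<Sigma> L \<psi>) \<and>
    (models \<Sigma> L (dual \<Sigma> \<phi>) \<longleftrightarrow> models \<Sigma> L (dual \<Sigma> \<psi>))"

text \<open>The first and last equivalences serve the universal quantifier and its dual, the middle
  two the existential quantifier and its dual.\<close>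

lemma equiv_dual_instances:
  assumes "list_all2 (\<lambda>x \<psi>. equiv_dual \<Sigma> L (f x) \<psi>) xs \<psi>s"
  shows "(\<forall>\<psi>\<in>set \<psi>s. models \<Sigma> L \<psi>) \<longleftrightarrow> (\<forall>x\<in>set xs. models \<Sigma> L (f x))"
    and "(\<exists>\<psi>\<in>set \<psi>s. models \<Sigma> L \<psi>) \<longleftrightarrow> (\<exists>x\<in>set xs. models \<Sigma> L (f x))"
    and "(\<forall>\<psi>\<in>set \<psi>s. models \<Sigma> L (dual \<Sigma> \<psi>)) \<longleftrightarrow> (\<forall>x\<in>set xs. models \<Sigma> L (dual \<Sigma> (f x)))"
    and "(\<exists>\<psi>\<in>set \<psi>s. models \<Sigma> L (dual \<Sigma> \<psi>)) \<longleftrightarrow> (\<exists>x\<in>set xs. models \<Sigma> L (dual \<Sigma> (f x)))"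
  using assms by (induction rule: list_all2_induct) (auto simp: equiv_dual_def)

lemma closed_subst_map_upds:
  assumes "wf_signature \<Sigma>" "set ts \<subseteq> domain \<Sigma>" "length ts = length xs" "fv_fm \<phi> \<subseteq> set xs"
  shows "closed (subst_fm [xs [\<mapsto>] ts] \<phi>)"
  using fv_subst_fm[OF ground_subst_domain[OF assms(1,2)], of xs \<phi>] assms(3,4) by auto

text \<open>Induction follows the derivation of \<open>reduce\<close>, which supplies hypotheses for
  the instances of the body at the computed tuples.\<close>

lemma reduce_equiv_dual:
  assumes "wf_signature \<Sigma>" "sat_spec \<Sigma> sat L" "partial_structure \<Sigma> L'" "extends L' L"
  shows "reduce sat L \<phi> \<psi> \<Longrightarrow> wf_fm \<phi> \<Longrightarrow> closed \<phi> \<Longrightarrow> equiv_dual \<Sigma> L' \<phi> \<psi>"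
proof (induction rule: reduce.induct)
  case (atom P)
  have "L' (dual_atom \<Sigma> P) = dual_tv (L' P)"
    using assms(3) atom(1) by (auto simp: partial_structure_def)
  \<comment> \<open>A value decided in \<open>L\<close> persists, matching \<open>Top\<close> or
    \<open>Bot\<close>; an undecided atom is its own reduct.\<close>
  moreover have "L P \<in> {TT, FF} \<Longrightarrow> L' P = L P"
    using assms(4) atom(1) by (auto simp: extends_def)
  ultimately show ?case by (cases "L P") (auto simp: equiv_dual_def)
next
  case (all c \<sigma>s xs \<phi> \<psi>s S)
  have xs: "distinct xs" "fv_restr c \<subseteq> set xs"
    and \<phi>: "wf_fm \<phi>" "fv_fm \<phi> \<subseteq> set xs"
    using all.prems by auto
  note S = fset_of_list_inst_properties[OF assms(1,2,4) all.hyps(1,3) xs, folded all.hyps(4)]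
  have S_eq: "fset S = inst xs ` set \<sigma>s"
    by (simp add: all.hyps(4) fset_of_list.rep_eq)
  have S': "\<forall>ts\<in>fset S. length ts = length xs \<and> set ts \<subseteq> domain \<Sigma> \<and>
      fv_restr (subst_restr [xs [\<mapsto>] ts] c) = {} \<and> models_restr \<Sigma> L' (subst_restr [xs [\<mapsto>] ts] c)"
    using S by blast
  \<comment> \<open>The body stays schematic. Dualising keeps \<open>xs\<close> and the restriction
    and only switches the quantifier, so the same \<open>S\<close> serves \<phi> under
    \<open>All\<close> and its dual under \<open>Ex\<close>.\<close>
  note split = models_quantifier_split[OF assms(1,3) xs(1) S', unfolded S_eq]
  have IH: "list_all2 (\<lambda>\<sigma> \<psi>. equiv_dual \<Sigma> L' (subst_fm [xs [\<mapsto>] inst xs \<sigma>] \<phi>) \<psi>) \<sigma>s \<psi>s"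
    \<comment> \<open>Each hypothesis presupposes a well-formed, closed instance; closedness holds
      because the tuples consist of ground domain elements.\<close>
    by (rule list.rel_mono_strong[OF all.IH])
      (auto intro!: wf_subst_fm \<phi>(1) closed_subst_map_upds[OF assms(1) S(2,1) \<phi>(2)]
        simp: all.hyps(4) fset_of_list_elem)
  show ?case
    using equiv_dual_instances[OF IH]
    by (simp add: equiv_dual_def split models_foldr_And models_foldr_Or dual_foldr_And subst_dual
        del: models.simps(6,7))
next
  case (ex c \<sigma>s xs \<phi> \<psi>s S)
  have xs: "distinct xs" "fv_restr c \<subseteq> set xs"
    and \<phi>: "wf_fm \<phi>" "fv_fm \<phi> \<subseteq> set xs"
    using ex.prems by auto
  note S = fset_of_list_inst_properties[OF assms(1,2,4) ex.hyps(1,3) xs, folded ex.hyps(4)]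
  have S_eq: "fset S = inst xs ` set \<sigma>s"
    by (simp add: ex.hyps(4) fset_of_list.rep_eq)
  have S': "\<forall>ts\<in>fset S. length ts = length xs \<and> set ts \<subseteq> domain \<Sigma> \<and>
      fv_restr (subst_restr [xs [\<mapsto>] ts] c) = {} \<and> models_restr \<Sigma> L' (subst_restr [xs [\<mapsto>] ts] c)"
    using S by blast
  note split = models_quantifier_split[OF assms(1,3) xs(1) S', unfolded S_eq]
  have IH: "list_all2 (\<lambda>\<sigma> \<psi>. equiv_dual \<Sigma> L' (subst_fm [xs [\<mapsto>] inst xs \<sigma>] \<phi>) \<psi>) \<sigma>s \<psi>s"
    by (rule list.rel_mono_strong[OF ex.IH])
      (auto intro!: wf_subst_fm \<phi>(1) closed_subst_map_upds[OF assms(1) S(2,1) \<phi>(2)]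
        simp: ex.hyps(4) fset_of_list_elem)
  show ?case
    \<comment> \<open>The quantifier clauses of \<open>models\<close> are withheld from the
      simplifier so that \<open>split\<close> rewrites the quantifiers whole, and
      \<open>subst_dual\<close> matches the dual instances with those of the hypothesis.\<close>
    using equiv_dual_instances[OF IH]
    by (simp add: equiv_dual_def split models_foldr_And models_foldr_Or dual_foldr_Or subst_dual
        del: models.simps(6,7))
qed (auto simp: equiv_dual_def)

theorem mainTheorem5:
  fixes \<Sigma> :: "('f, 'v, 'o, 's) signature"
    and sat :: "('f, 'v, 'o, 's) sat_fun"
    and L :: "('f, 'v, 'o, 's) struct"
    and \<phi> \<psi> :: "('f, 'v, 'o, 's) fm"
  assumes "wf_signature \<Sigma>"
    and "partial_structure \<Sigma> L"
    and "sat_spec \<Sigma> sat L"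
    and "wf_fm \<phi>"
    and "closed \<phi>"
    and "reduce sat L \<phi> \<psi>"
  shows "\<forall>L'. partial_structure \<Sigma> L' \<and> extends L' L \<longrightarrow>
    (models \<Sigma> L' \<phi> \<longleftrightarrow> models \<Sigma> L' \<psi>) \<and>
    (models \<Sigma> L' (dual \<Sigma> \<phi>) \<longleftrightarrow> models \<Sigma> L' (dual \<Sigma> \<psi>))"
  using reduce_equiv_dual[OF assms(1,3) _ _ assms(6,4,5)] unfolding equiv_dual_def by blast

end
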